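(* Suppose that $\mathcal M$ is a Runge-Kutta method with local truncation error of order $p\ge1$. Given any $h_0>0$ and any $-\alpha<0$, one can find a function $\lambda:(t_0,\infty)\to\mathbb R$, bounded and $C^{p+1}$, so that the scalar equation $\dot z=\lambda(t)z$ has Sacker-Sell spectrum with right endpoint given by $-\alpha$ and the numerical solution of $\dot x(t)=\lambda(t)x(t)$ using $\mathcal M$ with fixed step-size $h_0>0$ and initial condition $x(t_0)=x_0\ne0$ grows at an exponential rate.
   Context: A one-step method $x_{n+1}=\varphi(x_n,t_n;f,h)$, with $t_{n+1}=t_n+h_n$, has local truncation error of order $p$ if, for $f\in C^{p+1}$ and sufficiently small $\sup_nh_n$, every solution $x(t)$ of $\dot x=f(x,t)$ satisfies $x(t_{n+1})-\varphi(x(t_n),t_n;f,h)=K_nh_n^{p+1}$ with $K_n=K(t_n)$ depending on $x(t)$ and its derivatives and bounded when $x(t)$ is bounded. Here $h_n=h_0$ for all $n$. The Sacker-Sell spectrum of $\dot z=\lambda(t)z$ is the set of $\mu\in\mathbb R$ for which $\dot z=(\lambda(t)-\mu)z$ does not admit an exponential dichotomy; for bounded continuous real $\lambda$ its right endpoint is $\limsup_{H\to\infty}\left(\sup_{t\ge t_0}\frac1H\int_t^{t+H}\lambda(\tau)d\tau\right)$. "Grows at an exponential rate" means there are $r>1$ and $c>0$ with $|x_n|\ge c\,r^n$ for all $n\ge0$. *)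

theory Defs
  imports "HOL-Analysis.Analysis"
begin

text \<open>Functions of class \<open>C\<^sup>k\<close> on the whole space: for \<open>k > 0\<close>, Frechet differentiable with
  every directional derivative of class \<open>C\<^bsup>k-1\<^esup>\<close>. In finite dimension this is the
  usual notion.\<close>

primrec class_C :: "nat \<Rightarrow> ('a::euclidean_space \<Rightarrow> 'b::real_normed_vector) \<Rightarrow> bool" where
  "class_C 0 f \<longleftrightarrow> continuous_on UNIV f"
| "class_C (Suc k) f \<longleftrightarrow>
     (\<exists>D. (\<forall>x. (f has_derivative D x) (at x)) \<and> (\<forall>v. class_C k (\<lambda>x. D x v)))"

definition is_solution_on ::
    "('x::real_normed_vector \<Rightarrow> real \<Rightarrow> 'x) \<Rightarrow> real set \<Rightarrow> (real \<Rightarrow> 'x) \<Rightarrow> bool" where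
  "is_solution_on f I x \<longleftrightarrow> (\<forall>t\<in>I. (x has_vector_derivative f (x t) t) (at t within I))"

text \<open>One step, from state \<open>x\<close> at time \<open>t\<close> to state \<open>y\<close>, of the Runge--Kutta method with Butcher
  tableau \<open>(A, b, c)\<close>, whose stages are indexed by the finite type \<open>'s\<close>; \<open>k $ i\<close> is the slope of
  stage \<open>i\<close>. The method may be implicit (\<open>A\<close> is arbitrary), so that the step is a relation: the
  stage equations may have no solution, or several.\<close>

definition rk_step ::
    "real^'s^'s \<Rightarrow> real^'s \<Rightarrow> real^'s \<Rightarrow> ('x::euclidean_space \<Rightarrow> real \<Rightarrow> 'x) \<Rightarrow>
     real \<Rightarrow> real \<Rightarrow> 'x \<Rightarrow> 'x \<Rightarrow> bool" where
  "rk_step A b c f h t x y \<longleftrightarrow>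
     (\<exists>k :: 'x^'s.
        (\<forall>i. k $ i = f (x + h *\<^sub>R (\<Sum>j\<in>UNIV. A $ i $ j *\<^sub>R k $ j)) (t + c $ i * h)) \<and>
        y = x + h *\<^sub>R (\<Sum>i\<in>UNIV. b $ i *\<^sub>R k $ i))"

text \<open>Local truncation error of order \<open>p\<close>, for equations with state space \<open>'x\<close>: the step started on
  a solution misses it by \<open>K h\<^bsup>p+1\<^esup>\<close>, where \<open>K\<close> is bounded uniformly in \<open>t\<close> and in small \<open>h\<close>. A
  solution on a compact interval is bounded; on an unbounded interval no uniform bound could be
  asked for, since the derivatives of \<open>f\<close> may be unbounded in \<open>t\<close> even along a bounded solution.
  The step \<open>y\<close> is existentially quantified because an implicit method may admit spurious solutions
  of the stage equations besides the one meant by the method.\<close>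

definition local_truncation_order ::
    "'x::euclidean_space itself \<Rightarrow> real^'s^'s \<Rightarrow> real^'s \<Rightarrow> real^'s \<Rightarrow> nat \<Rightarrow> bool" where
  "local_truncation_order X A b c p \<longleftrightarrow>
     (\<forall>(f :: 'x \<Rightarrow> real \<Rightarrow> 'x) t\<^sub>1 t\<^sub>2 x.
        class_C (p + 1) (\<lambda>(u, t). f u t) \<longrightarrow> is_solution_on f {t\<^sub>1..t\<^sub>2} x \<longrightarrow>
        (\<exists>C. \<exists>\<delta>>0. \<forall>t h. 0 < h \<and> h < \<delta> \<and> t\<^sub>1 \<le> t \<and> t + h \<le> t\<^sub>2 \<longrightarrow>
           (\<exists>y K. rk_step A b c f h t (x t) y \<and>
                  x (t + h) - y = h ^ (p + 1) *\<^sub>R K \<and> norm K \<le> C)))"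

text \<open>The step from \<open>t\<^sub>0\<close> evaluates \<open>f\<close> at the times \<open>t\<^sub>0 + c $ i * h\<close>, which need not lie to the
  right of \<open>t\<^sub>0\<close>; coefficients of non-autonomous equations are therefore taken on the whole line.\<close>

definition numerical_solution ::
    "real^'s^'s \<Rightarrow> real^'s \<Rightarrow> real^'s \<Rightarrow> ('x::euclidean_space \<Rightarrow> real \<Rightarrow> 'x) \<Rightarrow>
     real \<Rightarrow> real \<Rightarrow> 'x \<Rightarrow> (nat \<Rightarrow> 'x) \<Rightarrow> bool" where
  "numerical_solution A b c f h t\<^sub>0 x\<^sub>0 x \<longleftrightarrow>
     x 0 = x\<^sub>0 \<and> (\<forall>n. rk_step A b c f h (t\<^sub>0 + real n * h) (x n) (x (Suc n)))"

definition grows_exponentially :: "(nat \<Rightarrow> 'x::real_normed_vector) \<Rightarrow> bool" where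
  "grows_exponentially x \<longleftrightarrow> (\<exists>r>1. \<exists>c>0. \<forall>n. norm (x n) \<ge> c * r ^ n)"

text \<open>Exponential dichotomy on \<open>[t\<^sub>0, \<infinity>)\<close> of the scalar equation \<open>z' = a(t) z\<close>, in terms of a
  fundamental solution \<open>Z\<close> and a projection \<open>P\<close> of the one-dimensional state space.\<close>

definition exponential_dichotomy :: "real \<Rightarrow> (real \<Rightarrow> real) \<Rightarrow> bool" where
  "exponential_dichotomy t\<^sub>0 a \<longleftrightarrow>
     (\<exists>Z P K \<gamma>. is_solution_on (\<lambda>z t. a t * z) {t\<^sub>0..} Z \<and> (\<forall>t\<ge>t\<^sub>0. Z t \<noteq> 0) \<and>
        P * P = P \<and> K > 0 \<and> \<gamma> > 0 \<and>
        (\<forall>s t. t\<^sub>0 \<le> s \<and> s \<le> t \<longrightarrow> \<bar>Z t * P * inverse (Z s)\<bar> \<le> K * exp (- \<gamma> * (t - s))) \<and>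
        (\<forall>s t. t\<^sub>0 \<le> t \<and> t \<le> s \<longrightarrow> \<bar>Z t * (1 - P) * inverse (Z s)\<bar> \<le> K * exp (- \<gamma> * (s - t))))"

definition sacker_sell_spectrum :: "real \<Rightarrow> (real \<Rightarrow> real) \<Rightarrow> real set" where
  "sacker_sell_spectrum t\<^sub>0 a = {\<mu>. \<not> exponential_dichotomy t\<^sub>0 (\<lambda>t. a t - \<mu>)}"

definition right_endpoint :: "real set \<Rightarrow> real \<Rightarrow> bool" where
  "right_endpoint S e \<longleftrightarrow> e \<in> S \<and> (\<forall>\<mu>\<in>S. \<mu> \<le> e)"

end

theory Submission
  imports Defs
begin

text \<open>A Runge--Kutta method with step size \<open>h\<^sub>0\<close> samples the coefficient \<open>\<lambda>\<close> only at the stage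
  times \<open>t\<^sub>0 + n h\<^sub>0 + c\<^sub>i h\<^sub>0\<close>, and modulo \<open>h\<^sub>0\<close> these are finitely many points.  An
  \<open>h\<^sub>0\<close>-periodic \<open>\<lambda>\<close> can therefore take one constant value \<open>\<mu> > 0\<close> at every stage time, so that
  the method cannot tell the equation from the unstable equation \<open>x' = \<mu> x\<close>, and dip so far below
  zero between the stage times that its mean over a period is \<open>- \<alpha>\<close>.  The function
  \<open>\<lambda>(t) = \<mu> - M \<Prod>\<^sub>s (sin (\<pi> (t - s) / h\<^sub>0))\<^sup>2\<close>, where \<open>s\<close> runs through the set of the points
  \<open>t\<^sub>0 + c\<^sub>i h\<^sub>0\<close>, has these properties for a suitable \<open>M\<close>, and it is of class \<open>C\<^sup>k\<close> for every \<open>k\<close>.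

  The spectrum of the equation is governed by the mean alone: by periodicity an antiderivative of
  \<open>\<lambda>\<close> stays within a bounded distance of \<open>- \<alpha> t\<close>, and
  \<open>right_endpoint_of_bounded_deviation\<close> applies.

  The numerical solution is governed by \<open>\<mu>\<close> alone: one step multiplies the state by the stability
  function \<open>R(z) = 1 + z (b \<bullet> u)\<close>, where \<open>(I - z A) u\<close> is the vector of ones, at \<open>z = h\<^sub>0 \<mu>\<close>.
  The order condition, tested on a constant vector field, gives \<open>\<Sum>\<^sub>i b\<^sub>i = 1\<close> (\<open>consistent_weights\<close>).  Hence \<open>R(z) = 1 + z + O(z\<^sup>2)\<close>,
  which exceeds \<open>1\<close> for small \<open>z > 0\<close> (\<open>stability_function_exceeds_one\<close>), and \<open>\<mu> = z / h\<^sub>0\<close> is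
  admissible for every \<open>h\<^sub>0\<close>.  For such \<open>z\<close> the matrix \<open>I - z A\<close> is invertible, so that
  the steps of an implicit method exist and are unique.\<close>

section \<open>Smooth functions of one real variable\<close>

lemma class_C_SucI:
  fixes f f' :: "real \<Rightarrow> real"
  assumes "\<And>x. (f has_real_derivative f' x) (at x)" and "\<And>v. class_C k (\<lambda>x. f' x * v)"
  shows "class_C (Suc k) f"
proof -
  have "\<forall>x. (f has_derivative (\<lambda>v. f' x * v)) (at x)"
    using assms(1) by (simp add: has_field_derivative_def mult_commute_abs)
  then show ?thesis using assms(2) by auto
qed

lemma class_C_SucE:
  fixes f :: "real \<Rightarrow> real"
  assumes "class_C (Suc k) f"
  obtains f' where "\<And>x. (f has_real_derivative f' x) (at x)" and "class_C k f'"
proof -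
  obtain D where D: "\<And>x. (f has_derivative D x) (at x)" "\<And>v. class_C k (\<lambda>x. D x v)"
    using assms by auto
  have "D x = (\<lambda>v. D x 1 * v)" for x
  proof
    fix v
    interpret linear "D x" using D(1) has_derivative_linear by blast
    show "D x v = D x 1 * v" using scale[of v 1] by simp
  qed
  then have "(f has_real_derivative D x 1) (at x)" for x
    using D(1)[of x] by (metis has_field_derivative_def)
  then show thesis using D(2)[of 1] by (rule that)
qed

lemma class_C_const: "class_C k (\<lambda>x. c)"
proof (induction k arbitrary: c)
  case (Suc k)
  have "\<forall>x. ((\<lambda>x. c) has_derivative (\<lambda>v. 0)) (at x)" by auto
  then show ?case using Suc.IH[of 0] by (auto intro!: exI[of _ "\<lambda>x v. 0"])
qed auto

lemma class_C_imp_continuous: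
  fixes f :: "real \<Rightarrow> real"
  assumes "class_C k f" shows "continuous_on UNIV f"
proof (cases k)
  case 0
  then show ?thesis using assms by simp
next
  case (Suc m)
  then obtain f' where "\<And>x. (f has_real_derivative f' x) (at x)"
    using assms class_C_SucE by blast
  then show ?thesis
    by (meson DERIV_isCont continuous_at_imp_continuous_on)
qed

lemma class_C_Suc_imp:
  fixes f :: "real \<Rightarrow> real"
  shows "class_C (Suc k) f \<Longrightarrow> class_C k f"
proof (induction k arbitrary: f)
  case 0
  then show ?case using class_C_imp_continuous[of "Suc 0" f] by simp
next
  case (Suc k)
  from Suc.prems obtain D where "\<forall>x. (f has_derivative D x) (at x)"
      "\<forall>v. class_C (Suc k) (\<lambda>x. D x v)"
    unfolding class_C.simps(2)[of "Suc k"] by blast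
  then show ?case using Suc.IH unfolding class_C.simps(2)[of k] by blast
qed

lemma class_C_add:
  fixes f g :: "real \<Rightarrow> real"
  shows "class_C k f \<Longrightarrow> class_C k g \<Longrightarrow> class_C k (\<lambda>x. f x + g x)"
proof (induction k arbitrary: f g)
  case 0
  then show ?case by (auto intro: continuous_intros)
next
  case (Suc k)
  obtain D where D: "\<forall>x. (f has_derivative D x) (at x)" "\<forall>v. class_C k (\<lambda>x. D x v)"
    using Suc.prems(1) by auto
  obtain E where E: "\<forall>x. (g has_derivative E x) (at x)" "\<forall>v. class_C k (\<lambda>x. E x v)"
    using Suc.prems(2) by auto
  show ?case unfolding class_C.simps
    using D E Suc.IH by (intro exI[of _ "\<lambda>x v. D x v + E x v"]) (auto intro: has_derivative_add)
qed

lemma class_C_mult: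
  fixes f g :: "real \<Rightarrow> real"
  shows "class_C k f \<Longrightarrow> class_C k g \<Longrightarrow> class_C k (\<lambda>x. f x * g x)"
proof (induction k arbitrary: f g)
  case 0
  then show ?case by (auto intro: continuous_intros)
next
  case (Suc k)
  obtain f' where f': "\<And>x. (f has_real_derivative f' x) (at x)" "class_C k f'"
    using Suc.prems(1) class_C_SucE by blast
  obtain g' where g': "\<And>x. (g has_real_derivative g' x) (at x)" "class_C k g'"
    using Suc.prems(2) class_C_SucE by blast
  have "class_C k f" "class_C k g" using Suc.prems class_C_Suc_imp by blast+
  then have "class_C k (\<lambda>x. (f' x * g x + g' x * f x) * v)" for v
    by (intro Suc.IH class_C_add class_C_const f' g')
  then show ?case
    by (rule class_C_SucI[OF DERIV_mult[OF f'(1) g'(1)]])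
qed

lemma class_C_prod:
  fixes f :: "'i \<Rightarrow> real \<Rightarrow> real"
  shows "(\<And>i. i \<in> I \<Longrightarrow> class_C k (f i)) \<Longrightarrow> class_C k (\<lambda>x. \<Prod>i\<in>I. f i x)"
  by (induction I rule: infinite_finite_induct) (auto intro: class_C_mult class_C_const)

text \<open>The cosine in the derivative is a shifted sine, so that one induction over all phases
  suffices.\<close>

lemma class_C_sin:
  fixes a b :: real
  shows "class_C k (\<lambda>x. sin (a * x + b))"
proof (induction k arbitrary: b)
  case 0
  then show ?case by (auto intro!: continuous_intros)
next
  case (Suc k)
  have "((\<lambda>x. sin (a * x + b)) has_real_derivative a * sin (a * x + (b + pi / 2))) (at x)" for x
    by (auto intro!: derivative_eq_intros simp: sin_add[of "a * x + b" "pi / 2"] simp flip: add.assoc)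
  then show ?case
    by (rule class_C_SucI) (intro class_C_mult class_C_const Suc.IH)
qed

section \<open>A periodic weight vanishing at prescribed times\<close>

definition sine_weight :: "real \<Rightarrow> real set \<Rightarrow> real \<Rightarrow> real" where
  "sine_weight h S t = (\<Prod>s\<in>S. (sin (pi * (t - s) / h))\<^sup>2)"

lemma class_C_sine_weight: "class_C k (sine_weight h S)"
proof -
  have "(\<lambda>t. sin (pi * (t - s) / h)) = (\<lambda>t. sin (pi / h * t + - (pi * s / h)))" for s
    by (simp add: algebra_simps diff_divide_distrib)
  then have "class_C k (\<lambda>t. sin (pi * (t - s) / h))" for s
    by (simp only: class_C_sin)
  then show ?thesis
    unfolding sine_weight_def[abs_def] power2_eq_square by (intro class_C_prod class_C_mult)
qed

lemma sine_weight_nonneg: "0 \<le> sine_weight h S t"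
  by (simp add: sine_weight_def prod_nonneg)

lemma sine_weight_le_1: "sine_weight h S t \<le> 1"
  unfolding sine_weight_def by (intro prod_le_1) (auto simp: abs_square_le_1)

lemma sine_weight_periodic:
  assumes "h > 0"
  shows "sine_weight h S (t + h) = sine_weight h S t"
proof -
  have "pi * (t + h - s) / h = pi * (t - s) / h + pi" for s
    using assms by (simp add: field_simps)
  then show ?thesis by (simp add: sine_weight_def)
qed

lemma sine_weight_eq_0:
  assumes "h > 0" and "finite S" and "s \<in> S"
  shows "sine_weight h S (s + real n * h) = 0"
proof -
  have "sin (pi * (s + real n * h - s) / h) = 0"
    using assms(1) by (simp add: mult.commute)
  then show ?thesis
    using assms(2,3) unfolding sine_weight_def
    by (intro prod_zero bexI[of _ s]) (simp_all only: zero_power2)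
qed

text \<open>The zeros form a countable set, so that they cannot fill a period.\<close>

lemma sine_weight_not_zero:
  assumes "h > 0" and "finite S"
  obtains t where "t \<in> {0..h}" and "sine_weight h S t \<noteq> 0"
proof -
  let ?Z = "\<Union>s\<in>S. range (\<lambda>i::int. s + of_int i * h)"
  have "countable ?Z" using assms(2) by (auto intro: countable_finite)
  moreover have "uncountable {0..h}"
    using assms(1) by (simp add: uncountable_closed_interval)
  ultimately obtain t where t: "t \<in> {0..h}" "t \<notin> ?Z"
    by (meson countable_subset subsetI)
  have "sin (pi * (t - s) / h) \<noteq> 0" if "s \<in> S" for s
  proof
    assume "sin (pi * (t - s) / h) = 0"
    then obtain i :: int where "pi * (t - s) / h = of_int i * pi" by (auto simp: sin_zero_iff_int2)
    then have "pi * (t - s) = pi * (of_int i * h)" using assms(1) by (simp add: field_simps)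
    then have "t - s = of_int i * h" by (simp only: mult_cancel_left) simp
    then have "t = s + of_int i * h" by simp
    then show False using t(2) that by auto
  qed
  then have "sine_weight h S t \<noteq> 0" using assms(2) by (simp add: sine_weight_def)
  with t(1) show thesis using that by blast
qed

text \<open>The increment \<open>I\<close> of an antiderivative over a period is the integral of the weight over a
  period.  Its positivity allows the mean of a coefficient \<open>\<mu> - M * sine_weight h S t\<close> to be
  prescribed by the choice of \<open>M\<close>.\<close>

lemma sine_weight_antiderivative:
  assumes "h > 0" and "finite S"
  obtains W I where "\<And>t. (W has_real_derivative sine_weight h S t) (at t)"
    and "I > 0" and "\<And>t. W (t + h) = W t + I"
proof -
  let ?w = "sine_weight h S"
  have cont: "continuous_on UNIV ?w"
    using class_C_sine_weight[of 0] by simp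
  then have "isCont ?w t" for t by (simp add: continuous_on_eq_continuous_at)
  then obtain W where W: "\<And>t. (W has_vector_derivative ?w t) (at t)"
    using einterval_antiderivative[of "-\<infinity>" "\<infinity>" ?w] by auto
  then have W': "(W has_real_derivative ?w t) (at t)" for t
    by (simp add: has_real_derivative_iff_has_vector_derivative)
  have "((\<lambda>t. W (t + h) - W t) has_real_derivative 0) (at t)" for t
    using DERIV_diff[OF DERIV_shift[THEN iffD1, OF W'[of "t + h"]] W'[of t]]
    by (simp add: sine_weight_periodic[OF assms(1)])
  then have shift: "W (t + h) - W t = W (0 + h) - W 0" for t
    by (meson DERIV_isconst_all)
  have int: "(?w has_integral (W h - W 0)) {0..h}"
    using assms(1) W by (intro fundamental_theorem_of_calculus) (auto intro: has_vector_derivative_at_within)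
  then have "W h - W 0 \<ge> 0" by (rule has_integral_nonneg) (rule sine_weight_nonneg)
  moreover have "W h - W 0 \<noteq> 0"
  proof
    assume "W h - W 0 = 0"
    obtain t where t: "t \<in> {0..h}" "?w t \<noteq> 0" using sine_weight_not_zero[OF assms] .
    have "?w t = 0"
      using has_integral_0_cbox_imp_0[of 0 h ?w t] int \<open>W h - W 0 = 0\<close> t(1) assms(1)
        sine_weight_nonneg continuous_on_subset[OF cont]
      by auto
    with t(2) show False by simp
  qed
  ultimately show thesis using that[of W "W h - W 0"] W' shift by (simp add: algebra_simps)
qed

lemma periodic_continuous_bounded:
  fixes g :: "real \<Rightarrow> real"
  assumes "h > 0" and "\<And>t. g (t + h) = g t" and "continuous_on UNIV g"
  obtains B where "\<And>t. \<bar>g t\<bar> \<le> B"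
proof -
  interpret periodic_fun_simple g h by unfold_locales (rule assms(2))
  have "compact (g ` {0..h})"
    using assms(3) by (intro compact_continuous_image) (auto intro: continuous_on_subset)
  then obtain B where B: "\<And>t. t \<in> {0..h} \<Longrightarrow> \<bar>g t\<bar> \<le> B"
    using compact_imp_bounded[of "g ` {0..h}"] unfolding bounded_iff by (metis imageI real_norm_def)
  have "\<bar>g t\<bar> \<le> B" for t
  proof -
    have "t - of_int \<lfloor>t / h\<rfloor> * h \<in> {0..h}"
      using floor_divide_lower[OF assms(1), of t] floor_divide_upper[OF assms(1), of t]
      by (auto simp: algebra_simps)
    from B[OF this] show ?thesis by (simp add: minus_of_int)
  qed
  then show thesis using that by blast
qed

section \<open>The spectrum of an equation with bounded deviation from its mean growth\<close>

lemma scalar_solution: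
  fixes G g Z :: "real \<Rightarrow> real"
  assumes Z: "is_solution_on (\<lambda>z t. g t * z) {t\<^sub>0..} Z"
    and G: "\<And>t. t \<ge> t\<^sub>0 \<Longrightarrow> (G has_real_derivative g t) (at t)"
    and "s \<ge> t\<^sub>0" "t \<ge> t\<^sub>0"
  shows "Z t = Z s * exp (G t - G s)"
proof -
  have "((\<lambda>t. Z t * exp (- G t)) has_real_derivative 0) (at t within {t\<^sub>0..})"
    if "t \<in> {t\<^sub>0..}" for t
  proof -
    have "(Z has_real_derivative g t * Z t) (at t within {t\<^sub>0..})"
      using Z that by (auto simp: is_solution_on_def has_real_derivative_iff_has_vector_derivative)
    moreover have "(G has_real_derivative g t) (at t within {t\<^sub>0..})"
      using G[of t] that by (auto intro: has_field_derivative_at_within)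
    ultimately show ?thesis by (auto intro!: derivative_eq_intros)
  qed
  then obtain C where C: "\<And>t. t \<ge> t\<^sub>0 \<Longrightarrow> Z t * exp (- G t) = C"
    using has_field_derivative_zero_constant[of "{t\<^sub>0..}" "\<lambda>t. Z t * exp (- G t)"] by auto
  have "Z t = C * exp (G t)" if "t \<ge> t\<^sub>0" for t
    using C[OF that] by (simp add: exp_minus field_simps)
  then show ?thesis using assms(3,4) by (simp add: exp_diff)
qed

text \<open>After the shift by \<open>e\<close> the transition factors \<open>Z t / Z s\<close> stay between \<open>exp (- 2 * B)\<close> and
  \<open>exp (2 * B)\<close>: they decay neither forwards nor backwards, so that neither of the two
  projections \<open>0\<close> and \<open>1\<close> of the line gives a dichotomy.  A shift by \<open>\<nu> > e\<close> multiplies them by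
  \<open>exp (- (\<nu> - e) * (t - s))\<close>, which is a dichotomy with projection \<open>1\<close>.\<close>

lemma right_endpoint_of_bounded_deviation:
  fixes L l :: "real \<Rightarrow> real"
  assumes L: "\<And>t. t \<ge> t\<^sub>0 \<Longrightarrow> (L has_real_derivative l t) (at t)"
    and B: "\<And>t. t \<ge> t\<^sub>0 \<Longrightarrow> \<bar>L t - e * t\<bar> \<le> B"
  shows "right_endpoint (sacker_sell_spectrum t\<^sub>0 l) e"
proof -
  define G where "G t = L t - e * t" for t
  have G: "(G has_real_derivative l t - e) (at t)" if "t \<ge> t\<^sub>0" for t
    unfolding G_def[abs_def] using L[OF that] by (auto intro!: derivative_eq_intros)
  have osc: "\<bar>G t - G s\<bar> \<le> 2 * B" if "t \<ge> t\<^sub>0" "s \<ge> t\<^sub>0" for s t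
    using B[OF that(1)] B[OF that(2)] by (auto simp: G_def)
  have "\<not> exponential_dichotomy t\<^sub>0 (\<lambda>t. l t - e)"
  proof
    assume "exponential_dichotomy t\<^sub>0 (\<lambda>t. l t - e)"
    then obtain Z P K \<gamma> where Z: "is_solution_on (\<lambda>z t. (l t - e) * z) {t\<^sub>0..} Z"
        "\<And>t. t \<ge> t\<^sub>0 \<Longrightarrow> Z t \<noteq> 0" and P: "P * P = P" and K: "K > 0" "\<gamma> > 0"
      and stable: "\<And>s t. t\<^sub>0 \<le> s \<Longrightarrow> s \<le> t \<Longrightarrow> \<bar>Z t * P * inverse (Z s)\<bar> \<le> K * exp (- \<gamma> * (t - s))"
      and unstable: "\<And>s t. t\<^sub>0 \<le> t \<Longrightarrow> t \<le> s \<Longrightarrow>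
            \<bar>Z t * (1 - P) * inverse (Z s)\<bar> \<le> K * exp (- \<gamma> * (s - t))"
      unfolding exponential_dichotomy_def by blast
    define d where "d = exp (- 2 * B)"
    have ratio: "\<bar>Z t * inverse (Z s)\<bar> \<ge> d" if "t \<ge> t\<^sub>0" "s \<ge> t\<^sub>0" for s t
    proof -
      have "Z t * inverse (Z s) = exp (G t - G s)"
        using scalar_solution[OF Z(1) G, of s t] that Z(2)[of s] by simp
      then show ?thesis using osc[OF that] by (simp add: d_def)
    qed
    \<comment> \<open>A time so large that the dichotomy bound has dropped below the lower bound of the transition
      factors.\<close>
    define T where "T = K / (d * \<gamma>)"
    have "d > 0" by (simp add: d_def)
    then have "T > 0" "\<gamma> * T = K / d" using K by (auto simp: T_def)
    have "K / d < exp (\<gamma> * T)"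
      using exp_ge_add_one_self[of "\<gamma> * T"] \<open>\<gamma> * T = K / d\<close> by linarith
    then have small: "K * exp (- \<gamma> * T) < d"
      using \<open>d > 0\<close> by (simp add: exp_minus field_simps)
    have "P = 0 \<or> P = 1" using P by simp
    then show False
    proof
      assume "P = 0"
      then show False
        using unstable[of t\<^sub>0 "t\<^sub>0 + T"] ratio[of t\<^sub>0 "t\<^sub>0 + T"] small \<open>T > 0\<close> by simp
    next
      assume "P = 1"
      then show False
        using stable[of t\<^sub>0 "t\<^sub>0 + T"] ratio[of "t\<^sub>0 + T" t\<^sub>0] small \<open>T > 0\<close> by simp
    qed
  qed
  moreover have "exponential_dichotomy t\<^sub>0 (\<lambda>t. l t - \<nu>)" if "\<nu> > e" for \<nu>
  proof -
    define Z where "Z t = exp (G t - (\<nu> - e) * t)" for t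
    have "(Z has_real_derivative (l t - \<nu>) * Z t) (at t within {t\<^sub>0..})" if "t \<ge> t\<^sub>0" for t
      unfolding Z_def[abs_def]
      by (rule has_field_derivative_at_within)
        (auto intro!: derivative_eq_intros G[OF that])
    then have "is_solution_on (\<lambda>z t. (l t - \<nu>) * z) {t\<^sub>0..} Z"
      by (auto simp: is_solution_on_def has_real_derivative_iff_has_vector_derivative)
    moreover have "\<bar>Z t * 1 * inverse (Z s)\<bar> \<le> exp (2 * B) * exp (- (\<nu> - e) * (t - s))"
      if "t\<^sub>0 \<le> s \<and> s \<le> t" for s t
    proof -
      have "Z t * 1 * inverse (Z s) = exp ((G t - G s) + (- (\<nu> - e) * (t - s)))"
        by (simp add: Z_def flip: exp_minus exp_add) (simp add: algebra_simps)
      also have "\<dots> \<le> exp (2 * B + (- (\<nu> - e) * (t - s)))"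
        using osc[of t s] that by simp
      finally show ?thesis by (simp add: exp_add Z_def)
    qed
    moreover have "\<forall>t\<ge>t\<^sub>0. Z t \<noteq> 0" by (simp add: Z_def)
    ultimately show ?thesis
      unfolding exponential_dichotomy_def
      using \<open>\<nu> > e\<close>
      by (intro exI[of _ Z] exI[of _ 1] exI[of _ "exp (2 * B)"] exI[of _ "\<nu> - e"]) auto
  qed
  ultimately show ?thesis
    unfolding right_endpoint_def sacker_sell_spectrum_def by (auto simp: not_less[symmetric])
qed

section \<open>The stability function for small arguments\<close>

text \<open>On a constant field \<open>e\<close> a step advances by \<open>\<sigma> h e\<close>, where \<open>\<sigma>\<close> is the sum of the weights, and
  the exact solution by \<open>h e\<close>.  The defect \<open>(1 - \<sigma>) h\<close> can be \<open>O(h\<^bsup>p+1\<^esup>)\<close> with \<open>p \<ge> 1\<close> only if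
  \<open>\<sigma> = 1\<close>.\<close>

lemma consistent_weights:
  fixes A :: "real^'s^'s" and b c :: "real^'s"
  assumes "p \<ge> 1" and "local_truncation_order TYPE('x::euclidean_space) A b c p"
  shows "(\<Sum>i\<in>UNIV. b $ i) = 1"
proof -
  define \<sigma> where "\<sigma> = (\<Sum>i\<in>UNIV. b $ i)"
  obtain e :: 'x where e: "norm e = 1" using vector_choose_size[of 1] by auto
  let ?f = "\<lambda>(u::'x) (t::real). e" and ?x = "\<lambda>t::real. t *\<^sub>R e"
  have "class_C (p + 1) (\<lambda>(u, t). ?f u t)"
    unfolding case_prod_beta' by (rule class_C_const)
  moreover have "is_solution_on ?f {0..1} ?x"
    unfolding is_solution_on_def by (auto intro!: derivative_eq_intros)
  ultimately obtain C \<delta> where "\<delta> > 0" and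
    C: "\<And>t h. 0 < h \<Longrightarrow> h < \<delta> \<Longrightarrow> 0 \<le> t \<Longrightarrow> t + h \<le> 1 \<Longrightarrow>
           \<exists>y K. rk_step A b c ?f h t (?x t) y \<and> ?x (t + h) - y = h ^ (p + 1) *\<^sub>R K \<and> norm K \<le> C"
    using assms(2)[unfolded local_truncation_order_def, rule_format, of ?f 0 1 ?x] by blast
  have defect: "\<bar>1 - \<sigma>\<bar> \<le> C * h" if h: "0 < h" "h < min \<delta> 1" for h
  proof -
    obtain y K where y: "rk_step A b c ?f h 0 (?x 0) y" "?x (0 + h) - y = h ^ (p + 1) *\<^sub>R K"
      and K: "norm K \<le> C"
      using C[of h 0] h by auto
    have "y = h *\<^sub>R \<sigma> *\<^sub>R e"
      using y(1) by (auto simp: rk_step_def \<sigma>_def scaleR_sum_left)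
    then have "h *\<^sub>R ((1 - \<sigma>) *\<^sub>R e) = h *\<^sub>R (h ^ p *\<^sub>R K)"
      using y(2) by (simp add: algebra_simps)
    then have "(1 - \<sigma>) *\<^sub>R e = h ^ p *\<^sub>R K" using h(1) by (simp only: scaleR_cancel_left) simp
    then have "\<bar>1 - \<sigma>\<bar> = h ^ p * norm K"
      using e h(1) by (metis abs_of_pos mult.right_neutral norm_scaleR zero_less_power)
    also have "\<dots> \<le> h * C"
      using power_decreasing[of 1 p h] assms(1) h K by (intro mult_mono) auto
    finally show ?thesis by (simp add: mult.commute)
  qed
  have "((\<lambda>h. C * h) \<longlongrightarrow> C * 0) (at_right 0)" by (intro tendsto_intros)
  moreover have "\<forall>\<^sub>F h in at_right 0. \<bar>1 - \<sigma>\<bar> \<le> C * h"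
    using defect \<open>\<delta> > 0\<close> by (intro eventually_at_rightI[of 0 "min \<delta> 1"]) auto
  ultimately have "\<bar>1 - \<sigma>\<bar> \<le> C * 0"
    by (intro tendsto_lowerbound[of _ _ "at_right 0"]) auto
  then show ?thesis by (simp add: \<sigma>_def)
qed

text \<open>The number \<open>1 + z * (b \<bullet> u)\<close>, where \<open>(I - z A) u\<close> is the vector of ones, is the stability
  function of the method at \<open>z\<close>.  It equals \<open>1 + z + O(z\<^sup>2)\<close>, and \<open>z\<close> is small enough for
  \<open>I - z A\<close> to be invertible and for the remainder to be at most \<open>z / 2\<close>.\<close>

lemma stability_function_exceeds_one:
  fixes A :: "real^'s^'s" and b :: "real^'s"
  assumes "(\<Sum>i\<in>UNIV. b $ i) = 1"
  obtains z u where "z > 0" and "u - z *\<^sub>R (A *v u) = 1" and "1 + z * (b \<bullet> u) > 1"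
    and "\<And>v. v - z *\<^sub>R (A *v v) = 0 \<Longrightarrow> v = 0"
proof -
  obtain K where K: "K > 0" "\<And>v. norm (A *v v) \<le> norm v * K"
    using bounded_linear.pos_bounded[OF matrix_vector_mul_bounded_linear[of A]] by blast
  define N where "N = norm b * norm (1 :: real^'s)"
  \<comment> \<open>Small enough for \<open>z * K \<le> 1 / 2\<close>, hence \<open>norm u \<le> 2 * norm 1\<close>, and for
    \<open>z * K * 2 * N < 1 / 2\<close>, which bounds the remainder of \<open>b \<bullet> u\<close>.\<close>
  define z where "z = 1 / (2 * K * (1 + 2 * N))"
  have "N \<ge> 0" by (simp add: N_def)
  moreover have "z * K = 1 / (2 * (1 + 2 * N))" using K(1) by (simp add: z_def)
  ultimately have z: "z > 0" "z * K \<le> 1 / 2" "z * K * 2 * N < 1 / 2"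
    using K(1) by (simp_all add: z_def)
  have zA: "norm (z *\<^sub>R (A *v v)) \<le> norm v / 2" for v
  proof -
    have "norm (z *\<^sub>R (A *v v)) \<le> z * (norm v * K)" using K(2)[of v] z(1) by simp
    also have "\<dots> = (z * K) * norm v" by simp
    also have "\<dots> \<le> 1 / 2 * norm v" using z(2) by (intro mult_right_mono) auto
    finally show ?thesis by simp
  qed
  have inj: "v = 0" if "v - z *\<^sub>R (A *v v) = 0" for v
  proof -
    have "z *\<^sub>R (A *v v) = v" using that by simp
    then have "norm v \<le> norm v / 2" using zA[of v] by simp
    then show ?thesis by simp
  qed
  have lin: "linear (\<lambda>v. v - z *\<^sub>R (A *v v))"
    by (intro linear_compose_sub linear_ident linear_compose_scale_right matrix_vector_mul_linear)
  then have "inj (\<lambda>v. v - z *\<^sub>R (A *v v))" using inj by (simp add: linear_injective_0)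
  then have "surj (\<lambda>v. v - z *\<^sub>R (A *v v))" using lin linear_injective_imp_surjective by blast
  then obtain u where "1 = u - z *\<^sub>R (A *v u)" by (rule surjE)
  then have u: "u - z *\<^sub>R (A *v u) = 1" by (rule sym)
  then have u': "u = 1 + z *\<^sub>R (A *v u)" by (simp only: diff_eq_eq)
  have "norm (1 + z *\<^sub>R (A *v u)) \<le> norm (1 :: real^'s) + norm u / 2"
    by (rule norm_triangle_le[OF add_left_mono[OF zA]])
  then have "norm u \<le> norm (1 :: real^'s) + norm u / 2" by (simp only: u'[symmetric])
  then have norm_u: "norm u \<le> 2 * norm (1 :: real^'s)" by simp
  have "b \<bullet> 1 = 1" using assms by (simp add: inner_vec_def)
  moreover have "b \<bullet> u = b \<bullet> (1 + z *\<^sub>R (A *v u))" by (simp only: u'[symmetric])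
  ultimately have "b \<bullet> u = 1 + z * (b \<bullet> (A *v u))" by (simp add: inner_add_right)
  moreover have "\<bar>z * (b \<bullet> (A *v u))\<bar> < 1 / 2"
  proof -
    have "\<bar>b \<bullet> (A *v u)\<bar> \<le> norm b * (norm u * K)"
      by (rule order_trans[OF Cauchy_Schwarz_ineq2]) (intro mult_left_mono K(2) norm_ge_zero)
    also have "\<dots> \<le> norm b * (2 * norm (1 :: real^'s) * K)"
      using norm_u K(1) by (intro mult_left_mono mult_right_mono) auto
    also have "\<dots> = K * 2 * N" by (simp add: N_def)
    finally have "z * \<bar>b \<bullet> (A *v u)\<bar> \<le> z * (K * 2 * N)"
      using z(1) by (intro mult_left_mono) auto
    also have "\<dots> < 1 / 2" using z(3) by (simp only: mult.assoc)
    finally show ?thesis using z(1) by (simp only: abs_mult abs_of_pos)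
  qed
  ultimately have "b \<bullet> u > 0" by linarith
  then show thesis using that[OF z(1) u _ inj] z(1) by simp
qed

text \<open>The step sees the coefficient only at the stage times, so that a common value \<open>\<mu>\<close> there
  turns the stage equations into those of \<open>x' = \<mu> x\<close>, with solution \<open>k = \<mu> x u\<close>.\<close>

lemma rk_step_linear_iff:
  fixes A :: "real^'s^'s" and b c :: "real^'s" and a :: "real \<Rightarrow> real"
  assumes a: "\<And>i. a (t + c $ i * h) = \<mu>"
    and u: "u - (h * \<mu>) *\<^sub>R (A *v u) = 1"
    and inj: "\<And>v. v - (h * \<mu>) *\<^sub>R (A *v v) = 0 \<Longrightarrow> v = 0"
  shows "rk_step A b c (\<lambda>u t. a t * u) h t x y \<longleftrightarrow> y = (1 + h * \<mu> * (b \<bullet> u)) * x"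
proof -
  have stages: "(\<forall>i. k $ i = a (t + c $ i * h) * (x + h *\<^sub>R (\<Sum>j\<in>UNIV. A $ i $ j *\<^sub>R k $ j)))
      \<longleftrightarrow> k = (\<mu> * x) *\<^sub>R u" for k :: "real^'s"
  proof -
    have "(\<forall>i. k $ i = a (t + c $ i * h) * (x + h *\<^sub>R (\<Sum>j\<in>UNIV. A $ i $ j *\<^sub>R k $ j)))
        \<longleftrightarrow> k - (h * \<mu>) *\<^sub>R (A *v k) = (\<mu> * x) *\<^sub>R 1"
      unfolding a by (simp add: vec_eq_iff matrix_vector_mult_def algebra_simps)
    also have "\<dots> \<longleftrightarrow> k - (h * \<mu>) *\<^sub>R (A *v k) = (\<mu> * x) *\<^sub>R (u - (h * \<mu>) *\<^sub>R (A *v u))"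
      by (simp only: u)
    also have "\<dots> \<longleftrightarrow> (k - (\<mu> * x) *\<^sub>R u) - (h * \<mu>) *\<^sub>R (A *v (k - (\<mu> * x) *\<^sub>R u)) = 0"
      by (simp add: matrix_vector_mult_diff_distrib matrix_vector_mult_scaleR algebra_simps)
    also have "\<dots> \<longleftrightarrow> k = (\<mu> * x) *\<^sub>R u"
      using inj[of "k - (\<mu> * x) *\<^sub>R u"] by (auto simp: matrix_vector_mult_0_right)
    finally show ?thesis .
  qed
  have "x + h *\<^sub>R (\<Sum>i\<in>UNIV. b $ i *\<^sub>R ((\<mu> * x) *\<^sub>R u) $ i) = (1 + h * \<mu> * (b \<bullet> u)) * x"
    by (simp add: inner_vec_def sum_distrib_left sum_distrib_right algebra_simps)
  then show ?thesis unfolding rk_step_def stages by simp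
qed

theorem theorem3p5:
  fixes A :: "real^'s^'s" and b c :: "real^'s" and p :: nat
    and h\<^sub>0 \<alpha> t\<^sub>0 :: real
  assumes "p \<ge> 1"
    and "local_truncation_order TYPE('x::euclidean_space) A b c p"
    and "h\<^sub>0 > 0"
    and "- \<alpha> < 0"
  shows "\<exists>l :: real \<Rightarrow> real.
           class_C (p + 1) l \<and> bounded (range l) \<and>
           right_endpoint (sacker_sell_spectrum t\<^sub>0 l) (- \<alpha>) \<and>
           (\<forall>x\<^sub>0. x\<^sub>0 \<noteq> 0 \<longrightarrow>
              (\<exists>x. numerical_solution A b c (\<lambda>u t. l t * u) h\<^sub>0 t\<^sub>0 x\<^sub>0 x \<and>
                   (\<forall>y. numerical_solution A b c (\<lambda>u t. l t * u) h\<^sub>0 t\<^sub>0 x\<^sub>0 y \<longrightarrow> y = x) \<and>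
                   grows_exponentially x))"
proof -
  obtain z u where z: "z > 0" and u: "u - z *\<^sub>R (A *v u) = 1"
    and R1: "1 + z * (b \<bullet> u) > 1" and inj: "\<And>v. v - z *\<^sub>R (A *v v) = 0 \<Longrightarrow> v = 0"
    using stability_function_exceeds_one[OF consistent_weights[OF assms(1,2)]] by blast
  define R where "R = 1 + z * (b \<bullet> u)"
  define S where "S = range (\<lambda>i. t\<^sub>0 + c $ i * h\<^sub>0)"
  have "finite S" by (simp add: S_def)
  let ?w = "sine_weight h\<^sub>0 S"
  obtain W I where W: "\<And>t. (W has_real_derivative ?w t) (at t)"
    and "I > 0" and shift: "\<And>t. W (t + h\<^sub>0) = W t + I"
    using sine_weight_antiderivative[OF assms(3) \<open>finite S\<close>] by blast
  define \<mu> where "\<mu> = z / h\<^sub>0"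
  \<comment> \<open>This amplitude makes the mean \<open>\<mu> - M * I / h\<^sub>0\<close> of the coefficient equal to \<open>- \<alpha>\<close>.\<close>
  define M where "M = (\<mu> + \<alpha>) * h\<^sub>0 / I"
  define l where "l t = \<mu> + (- M) * ?w t" for t
  define L where "L t = \<mu> * t - M * W t" for t

  have smooth: "class_C (p + 1) l"
    unfolding l_def[abs_def] by (intro class_C_add class_C_mult class_C_const class_C_sine_weight)
  have "\<bar>l t\<bar> \<le> \<bar>\<mu>\<bar> + \<bar>M\<bar>" for t
  proof -
    have "\<bar>M * ?w t\<bar> \<le> \<bar>M\<bar> * 1"
      unfolding abs_mult using sine_weight_nonneg[of h\<^sub>0 S t] sine_weight_le_1[of h\<^sub>0 S t]
      by (intro mult_left_mono) auto
    then show ?thesis unfolding l_def by linarith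
  qed
  then have bdd: "bounded (range l)" unfolding bounded_iff by auto

  have L: "(L has_real_derivative l t) (at t)" for t
    unfolding L_def[abs_def] l_def by (auto intro!: derivative_eq_intros W)
  have "M * I = (\<mu> + \<alpha>) * h\<^sub>0" using \<open>I > 0\<close> by (simp add: M_def)
  then have "L (t + h\<^sub>0) - - \<alpha> * (t + h\<^sub>0) = L t - - \<alpha> * t" for t
    unfolding L_def shift by (simp add: algebra_simps)
  moreover have "continuous_on UNIV (\<lambda>t. L t - - \<alpha> * t)"
    using L by (intro continuous_intros) (meson DERIV_isCont continuous_at_imp_continuous_on)
  ultimately obtain B where "\<And>t. \<bar>L t - - \<alpha> * t\<bar> \<le> B"
    using periodic_continuous_bounded[OF assms(3), of "\<lambda>t. L t - - \<alpha> * t"] by blast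
  then have spec: "right_endpoint (sacker_sell_spectrum t\<^sub>0 l) (- \<alpha>)"
    by (intro right_endpoint_of_bounded_deviation[of t\<^sub>0 L l "- \<alpha>" B] L)

  have stage: "l (t\<^sub>0 + real n * h\<^sub>0 + c $ i * h\<^sub>0) = \<mu>" for n i
  proof -
    have "t\<^sub>0 + c $ i * h\<^sub>0 \<in> S" unfolding S_def by blast
    from sine_weight_eq_0[OF assms(3) \<open>finite S\<close> this, of n] show ?thesis
      by (simp add: l_def add_ac)
  qed
  have "h\<^sub>0 * \<mu> = z" using assms(3) by (simp add: \<mu>_def)
  then have step: "rk_step A b c (\<lambda>u t. l t * u) h\<^sub>0 (t\<^sub>0 + real n * h\<^sub>0) x y \<longleftrightarrow> y = R * x" for n x y
    using rk_step_linear_iff[of l "t\<^sub>0 + real n * h\<^sub>0" c h\<^sub>0 \<mu> u A b x y, OF stage] u inj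
    by (simp add: R_def)
  have num: "numerical_solution A b c (\<lambda>u t. l t * u) h\<^sub>0 t\<^sub>0 x\<^sub>0 x \<longleftrightarrow> x = (\<lambda>n. x\<^sub>0 * R ^ n)" for x\<^sub>0 x
  proof
    assume "numerical_solution A b c (\<lambda>u t. l t * u) h\<^sub>0 t\<^sub>0 x\<^sub>0 x"
    then have "x 0 = x\<^sub>0" "\<And>n. x (Suc n) = R * x n" by (auto simp: numerical_solution_def step)
    then have "x n = x\<^sub>0 * R ^ n" for n by (induction n) auto
    then show "x = (\<lambda>n. x\<^sub>0 * R ^ n)" by blast
  qed (auto simp: numerical_solution_def step)
  have "grows_exponentially (\<lambda>n. x\<^sub>0 * R ^ n)" if "x\<^sub>0 \<noteq> 0" for x\<^sub>0 :: real
    unfolding grows_exponentially_def using that R1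
    by (intro exI[of _ R] conjI exI[of _ "\<bar>x\<^sub>0\<bar>"]) (auto simp: R_def abs_mult power_abs)
  then show ?thesis using smooth bdd spec num by blast
qed

end
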